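(* Let $\mathbf p=(p_1,\dots,p_r)$ and $\mathbf q=(q_1,\dots,q_r)$ be probability distributions on $\mathcal X=\{c_1,\dots,c_r\}$ with $p_j>0$ and $q_j>0$ for all $j\in D$, and let $\alpha>0$, $\alpha\ne1$. Let $\widehat{\mathbf p}_n$ and $\widehat{\mathbf q}_m$ be the empirical distributions of i.i.d. samples $X_1,\dots,X_n$ from $\mathbf p$ and $Y_1,\dots,Y_m$ from $\mathbf q$. Put $A_{R,\alpha,1}=A_{T,\alpha,1}/\mathcal S_\alpha(\mathbf p,\mathbf q)$ and $A_{R,\alpha,2}=A_{T,\alpha,2}/\mathcal S_\alpha(\mathbf p,\mathbf q)$. Then: (a) (One sample) $$\limsup_{n\to+\infty}\frac{|\mathcal D_{R,\alpha}(\widehat{\mathbf p}_n,\mathbf q)-\mathcal D_{R,\alpha}(\mathbf p,\mathbf q)|}{a_n}\le A_{R,\alpha,1}\quad\text{a.s.},\qquad\limsup_{n\to+\infty}\frac{|\mathcal D_{R,\alpha}(\mathbf p,\widehat{\mathbf q}_n)-\mathcal D_{R,\alpha}(\mathbf p,\mathbf q)|}{b_n}\le A_{R,\alpha,2}\quad\text{a.s.}$$ (b) (Two samples) $$\limsup_{(n,m)\to(+\infty,+\infty)}\frac{|\mathcal D_{R,\alpha}(\widehat{\mathbf p}_n,\widehat{\mathbf q}_m)-\mathcal D_{R,\alpha}(\mathbf p,\mathbf q)|}{c_{n,m}}\le A_{R,\alpha,1}+A_{R,\alpha,2}\quad\text{a.s.}$$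
   Context: $\mathcal X=\{c_1,\dots,c_r\}$ with $r\ge 2$ is a finite set of distinct points and $D=\{1,\dots,r\}$. A probability distribution $\mathbf p$ on $\mathcal X$ is identified with the vector $(p_1,\dots,p_r)$, $p_j$ being the mass of $c_j$. $X_1,X_2,\dots$ are i.i.d. with $\mathbb P(X_i=c_j)=p_j$, and $Y_1,Y_2,\dots$ are i.i.d. with $\mathbb P(Y_i=c_j)=q_j$; the two sequences are independent of each other. Empirical probabilities: $\widehat p_n^{c_j}=\frac1n\sum_{i=1}^n 1_{\{X_i=c_j\}}$, $\widehat q_m^{c_j}=\frac1m\sum_{i=1}^m 1_{\{Y_i=c_j\}}$, $\widehat{\mathbf p}_n=(\widehat p_n^{c_j})_{j\in D}$, $\widehat{\mathbf q}_m=(\widehat q_m^{c_j})_{j\in D}$. $a_n=\sup_{j\in D}|\widehat p_n^{c_j}-p_j|$, $b_m=\sup_{j\in D}|\widehat q_m^{c_j}-q_j|$, $c_{n,m}=\max(a_n,b_m)$. $\mathcal S_\alpha(\mathbf p,\mathbf q)=\sum_{j\in D}p_j^\alpha q_j^{1-\alpha}$; Renyi-$\alpha$ divergence: $\mathcal D_{R,\alpha}(\mathbf p,\mathbf q)=\frac1{\alpha-1}\log\mathcal S_\alpha(\mathbf p,\mathbf q)$ (natural logarithm). $$A_{T,\alpha,1}=\frac{\alpha}{|\alpha-1|}\sum_{j\in D}(p_j/q_j)^{\alpha-1},\qquad A_{T,\alpha,2}=\sum_{j\in D}(p_j/q_j)^{\alpha}.$$ Conventions: a ratio $0/0$ is read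 as $0$; if an empirical divergence is undefined because some empirical probability vanishes, it is given the value $0$; $\limsup_{(n,m)\to(+\infty,+\infty)}x_{n,m}=\lim_{N\to\infty}\sup_{n,m\ge N}x_{n,m}$. *)

theory Defs
  imports "HOL-Probability.Probability"
begin

text \<open>
  A probability distribution on the points \<open>c 1, \<dots>, c r\<close> is represented by its mass vector
  \<open>p :: nat \<Rightarrow> real\<close>, of which only the entries with index in \<open>{1..r}\<close> matter.
\<close>

definition prob_vector :: "nat \<Rightarrow> (nat \<Rightarrow> real) \<Rightarrow> bool" where
  "prob_vector r p \<longleftrightarrow> (\<forall>j\<in>{1..r}. 0 \<le> p j) \<and> (\<Sum>j\<in>{1..r}. p j) = 1"

text \<open>
  Measurability of each \<open>X i\<close> as a map into the finite set \<open>c ` {1..r}\<close> (with all subsets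
  measurable) is part of \<^const>\<open>prob_space.indep_vars\<close>. Samples are indexed from 1.
\<close>

definition iid_sample ::
  "'w measure \<Rightarrow> nat \<Rightarrow> (nat \<Rightarrow> 'a) \<Rightarrow> (nat \<Rightarrow> real) \<Rightarrow> (nat \<Rightarrow> 'w \<Rightarrow> 'a) \<Rightarrow> bool" where
  "iid_sample M r c p X \<longleftrightarrow>
     prob_space.indep_vars M (\<lambda>_. count_space (c ` {1..r})) X {1..} \<and>
     (\<forall>i\<ge>1. \<forall>j\<in>{1..r}. measure M {\<omega> \<in> space M. X i \<omega> = c j} = p j)"

text \<open>The two sequences are independent as random elements of the product space.\<close>

definition indep_samples ::
  "'w measure \<Rightarrow> nat \<Rightarrow> (nat \<Rightarrow> 'a) \<Rightarrow> (nat \<Rightarrow> 'w \<Rightarrow> 'a) \<Rightarrow> (nat \<Rightarrow> 'w \<Rightarrow> 'a) \<Rightarrow> bool" where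
  "indep_samples M r c X Y \<longleftrightarrow>
     prob_space.indep_var M
       (\<Pi>\<^sub>M i\<in>{1..}. count_space (c ` {1..r})) (\<lambda>\<omega>. \<lambda>i\<in>{1..}. X i \<omega>)
       (\<Pi>\<^sub>M i\<in>{1..}. count_space (c ` {1..r})) (\<lambda>\<omega>. \<lambda>i\<in>{1..}. Y i \<omega>)"

definition empirical :: "(nat \<Rightarrow> 'a) \<Rightarrow> (nat \<Rightarrow> 'w \<Rightarrow> 'a) \<Rightarrow> nat \<Rightarrow> 'w \<Rightarrow> nat \<Rightarrow> real" where
  "empirical c X n \<omega> j = 1 / real n * (\<Sum>i\<in>{1..n}. indicator {\<omega>'. X i \<omega>' = c j} \<omega>)"

definition sup_dev :: "nat \<Rightarrow> (nat \<Rightarrow> real) \<Rightarrow> (nat \<Rightarrow> real) \<Rightarrow> real" where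
  "sup_dev r u v = (SUP j\<in>{1..r}. \<bar>u j - v j\<bar>)"

definition S_alpha :: "nat \<Rightarrow> real \<Rightarrow> (nat \<Rightarrow> real) \<Rightarrow> (nat \<Rightarrow> real) \<Rightarrow> real" where
  "S_alpha r \<alpha> p q = (\<Sum>j\<in>{1..r}. p j powr \<alpha> * q j powr (1 - \<alpha>))"

text \<open>
  The divergence of two mass vectors is undefined if some summand is a positive number divided
  by zero (\<open>\<alpha> > 1\<close>, \<open>q j = 0 < p j\<close>) or if the logarithm of 0 would be taken; in
  particular it is always defined for strictly positive vectors. A summand with
  \<open>p j = q j = 0\<close> is 0, which for \<open>\<alpha> > 1\<close> is the convention 0/0 = 0; since \<open>0 powr x = 0\<close>,
  \<^const>\<open>S_alpha\<close> has the right value whenever the condition below holds.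
  An undefined divergence is given the value 0.
\<close>

definition renyi_defined :: "nat \<Rightarrow> real \<Rightarrow> (nat \<Rightarrow> real) \<Rightarrow> (nat \<Rightarrow> real) \<Rightarrow> bool" where
  "renyi_defined r \<alpha> p q \<longleftrightarrow>
     (\<alpha> > 1 \<longrightarrow> (\<forall>j\<in>{1..r}. q j = 0 \<longrightarrow> p j = 0)) \<and> S_alpha r \<alpha> p q > 0"

definition renyi_div :: "nat \<Rightarrow> real \<Rightarrow> (nat \<Rightarrow> real) \<Rightarrow> (nat \<Rightarrow> real) \<Rightarrow> real" where
  "renyi_div r \<alpha> p q =
     (if renyi_defined r \<alpha> p q then 1 / (\<alpha> - 1) * ln (S_alpha r \<alpha> p q) else 0)"

definition A_T1 :: "nat \<Rightarrow> real \<Rightarrow> (nat \<Rightarrow> real) \<Rightarrow> (nat \<Rightarrow> real) \<Rightarrow> real" where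
  "A_T1 r \<alpha> p q = \<alpha> / \<bar>\<alpha> - 1\<bar> * (\<Sum>j\<in>{1..r}. (p j / q j) powr (\<alpha> - 1))"

definition A_T2 :: "nat \<Rightarrow> real \<Rightarrow> (nat \<Rightarrow> real) \<Rightarrow> (nat \<Rightarrow> real) \<Rightarrow> real" where
  "A_T2 r \<alpha> p q = (\<Sum>j\<in>{1..r}. (p j / q j) powr \<alpha>)"

definition A_R1 :: "nat \<Rightarrow> real \<Rightarrow> (nat \<Rightarrow> real) \<Rightarrow> (nat \<Rightarrow> real) \<Rightarrow> real" where
  "A_R1 r \<alpha> p q = A_T1 r \<alpha> p q / S_alpha r \<alpha> p q"

definition A_R2 :: "nat \<Rightarrow> real \<Rightarrow> (nat \<Rightarrow> real) \<Rightarrow> (nat \<Rightarrow> real) \<Rightarrow> real" where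
  "A_R2 r \<alpha> p q = A_T2 r \<alpha> p q / S_alpha r \<alpha> p q"

definition limsup2 :: "(nat \<Rightarrow> nat \<Rightarrow> ereal) \<Rightarrow> ereal" where
  "limsup2 x = lim (\<lambda>N. SUP (n, m)\<in>{N..} \<times> {N..}. x n m)"

lemma limsup2_eq_Limsup:
  "limsup2 x = Limsup (sequentially \<times>\<^sub>F sequentially) (\<lambda>(n, m). x n m)"
proof -
  let ?s = "\<lambda>N. SUP (n, m)\<in>{N..} \<times> {N..}. x n m"
  have "decseq ?s"
    by (intro antimonoI SUP_subset_mono) auto
  then have "?s \<longlonglongrightarrow> (INF N. ?s N)"
    by (rule LIMSEQ_INF)
  then have 1: "limsup2 x = (INF N. ?s N)"
    unfolding limsup2_def by (rule limI)
  have "(INF N. ?s N) = Limsup (sequentially \<times>\<^sub>F sequentially) (\<lambda>(n, m). x n m)"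
    unfolding Limsup_def
  proof (rule antisym)
    show "(INF N. ?s N) \<le> (INF P\<in>{P. eventually P (sequentially \<times>\<^sub>F sequentially)}.
        SUP y\<in>Collect P. case y of (n, m) \<Rightarrow> x n m)"
    proof (rule INF_greatest)
      fix P :: "nat \<times> nat \<Rightarrow> bool"
      assume "P \<in> {P. eventually P (sequentially \<times>\<^sub>F sequentially)}"
      then obtain N where "\<forall>m\<ge>N. \<forall>n\<ge>N. P (n, m)"
        by (auto simp: eventually_prod_sequentially)
      then have "?s N \<le> (SUP y\<in>Collect P. case y of (n, m) \<Rightarrow> x n m)"
        by (intro SUP_subset_mono) auto
      then show "(INF N. ?s N) \<le> (SUP y\<in>Collect P. case y of (n, m) \<Rightarrow> x n m)"
        by (rule INF_lower2[OF UNIV_I])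
    qed
    show "(INF P\<in>{P. eventually P (sequentially \<times>\<^sub>F sequentially)}.
        SUP y\<in>Collect P. case y of (n, m) \<Rightarrow> x n m) \<le> (INF N. ?s N)"
    proof (rule INF_greatest)
      fix N :: nat
      have "eventually (\<lambda>y. y \<in> {N..} \<times> {N..}) (sequentially \<times>\<^sub>F sequentially)"
        by (auto simp: eventually_prod_sequentially)
      then show "(INF P\<in>{P. eventually P (sequentially \<times>\<^sub>F sequentially)}.
          SUP y\<in>Collect P. case y of (n, m) \<Rightarrow> x n m) \<le> ?s N"
        by (intro INF_lower2[of "\<lambda>y. y \<in> {N..} \<times> {N..}"]) auto
    qed
  qed
  with 1 show ?thesis by simp
qed

end

theory Submission
  imports Defs
begin

text \<open>
  Write \<open>S\<close> as a sum of terms \<open>exp (\<alpha> ln p\<^sub>j + (1 - \<alpha>) ln q\<^sub>j)\<close>. A first-order estimate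
  with separate constants for the deviations in \<open>p\<close> and in \<open>q\<close> is preserved by sums and, by the
  chain rule, by differentiable maps; tracking the constants from the coordinates through \<open>S\<close> to
  \<open>ln S / (\<alpha> - 1)\<close> produces exactly \<open>A\<^sub>R\<^sub>,\<^sub>1\<close> and \<open>A\<^sub>R\<^sub>,\<^sub>2\<close>. The estimate holds along
  every filter on which the mass vectors converge, so it covers both the one-sample and the
  two-sample limits. Almost sure convergence of the empirical probabilities follows from
  Hoeffding's inequality and the Borel--Cantelli lemma.
\<close>

section \<open>First-order estimates along a filter\<close>

text \<open>
  That is, \<open>\<bar>f - l\<bar> \<le> (A + o(1)) a + (B + o(1)) b\<close> along \<open>F\<close>; \<open>a\<close> and \<open>b\<close> stay
  separate so that a sample which is not varied contributes nothing.
\<close>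

definition lin_bound ::
  "'i filter \<Rightarrow> ('i \<Rightarrow> real) \<Rightarrow> ('i \<Rightarrow> real) \<Rightarrow> ('i \<Rightarrow> real) \<Rightarrow> real \<Rightarrow> real \<Rightarrow> real \<Rightarrow> bool" where
  "lin_bound F a b f l A B \<longleftrightarrow>
     (\<forall>\<epsilon>>0. \<forall>\<^sub>F i in F. \<bar>f i - l\<bar> \<le> (A + \<epsilon>) * a i + (B + \<epsilon>) * b i)"

lemma lin_boundD:
  "lin_bound F a b f l A B \<Longrightarrow> \<epsilon> > 0 \<Longrightarrow> \<forall>\<^sub>F i in F. \<bar>f i - l\<bar> \<le> (A + \<epsilon>) * a i + (B + \<epsilon>) * b i"
  by (simp add: lin_bound_def)

lemma lin_bound_const: "(\<And>i. 0 \<le> a i) \<Longrightarrow> (\<And>i. 0 \<le> b i) \<Longrightarrow> lin_bound F a b (\<lambda>_. l) l 0 0"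
  by (simp add: lin_bound_def)

lemma lin_bound_cong:
  assumes "lin_bound F a b f l A B" "\<forall>\<^sub>F i in F. f i = g i"
  shows "lin_bound F a b g l A B"
  unfolding lin_bound_def
proof (intro allI impI)
  fix \<epsilon> :: real assume "\<epsilon> > 0"
  then have "\<forall>\<^sub>F i in F. \<bar>f i - l\<bar> \<le> (A + \<epsilon>) * a i + (B + \<epsilon>) * b i"
    using assms(1) unfolding lin_bound_def by blast
  with assms(2) show "\<forall>\<^sub>F i in F. \<bar>g i - l\<bar> \<le> (A + \<epsilon>) * a i + (B + \<epsilon>) * b i"
    by eventually_elim simp
qed

lemma lin_bound_add:
  assumes "lin_bound F a b f l A B" "lin_bound F a b g m C D"
  shows "lin_bound F a b (\<lambda>i. f i + g i) (l + m) (A + C) (B + D)"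
  unfolding lin_bound_def
proof (intro allI impI)
  fix \<epsilon> :: real assume "\<epsilon> > 0"
  then have h: "\<epsilon> / 2 > 0" by simp
  have "\<forall>\<^sub>F i in F. \<bar>f i - l\<bar> \<le> (A + \<epsilon> / 2) * a i + (B + \<epsilon> / 2) * b i"
       "\<forall>\<^sub>F i in F. \<bar>g i - m\<bar> \<le> (C + \<epsilon> / 2) * a i + (D + \<epsilon> / 2) * b i"
    using assms[THEN lin_boundD, OF h] by simp_all
  then show "\<forall>\<^sub>F i in F. \<bar>f i + g i - (l + m)\<bar> \<le> (A + C + \<epsilon>) * a i + (B + D + \<epsilon>) * b i"
    by eventually_elim (simp add: algebra_simps)
qed

lemma lin_bound_sum:
  assumes "\<And>i. 0 \<le> a i" "\<And>i. 0 \<le> b i"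
    and "\<And>j. j \<in> J \<Longrightarrow> lin_bound F a b (f j) (l j) (A j) (B j)"
  shows "lin_bound F a b (\<lambda>i. \<Sum>j\<in>J. f j i) (\<Sum>j\<in>J. l j) (\<Sum>j\<in>J. A j) (\<Sum>j\<in>J. B j)"
  using assms(3)
\<comment> \<open>For infinite \<open>J\<close> all sums are 0 by convention, so this case, like the
  empty one, reduces to \<open>lin_bound_const\<close>.\<close>
proof (induction J rule: infinite_finite_induct)
  case (insert x J)
  then show ?case by (simp add: lin_bound_add)
qed (simp_all add: lin_bound_const assms)

text \<open>The single choice \<epsilon> = 1 is enough: fixed multiples of the two null functions
  \<open>a\<close> and \<open>b\<close> still tend to 0.\<close>

lemma lin_bound_tendsto:
  assumes "lin_bound F a b f l A B" and a: "(a \<longlongrightarrow> 0) F" and b: "(b \<longlongrightarrow> 0) F"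
  shows "(f \<longlongrightarrow> l) F"
proof -
  have "\<forall>\<^sub>F i in F. \<bar>f i - l\<bar> \<le> (A + 1) * a i + (B + 1) * b i"
    using lin_boundD[OF assms(1), of 1] by simp
  moreover have "((\<lambda>i. (A + 1) * a i + (B + 1) * b i) \<longlongrightarrow> 0) F"
    using a b by (intro tendsto_add_zero tendsto_mult_right_zero)
  ultimately have "((\<lambda>i. f i - l) \<longlongrightarrow> 0) F"
    by (intro Lim_null_comparison[where f = "\<lambda>i. f i - l"]) simp_all
  then show ?thesis by (simp add: LIM_zero_iff)
qed

text \<open>Near \<open>l\<close> the map \<open>g\<close> is Lipschitz at \<open>l\<close> with any
  constant above \<open>\<bar>D\<bar>\<close>. Multiplying this constant by those of
  \<open>f\<close> costs an arbitrarily small error, which \<epsilon> absorbs.\<close>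

lemma lin_bound_compose:
  assumes f: "lin_bound F a b f l A B"
    and g: "(g has_real_derivative D) (at l)"
    and a: "(a \<longlongrightarrow> 0) F" "\<And>i. 0 \<le> a i" and b: "(b \<longlongrightarrow> 0) F" "\<And>i. 0 \<le> b i"
  shows "lin_bound F a b (\<lambda>i. g (f i)) (g l) (\<bar>D\<bar> * A) (\<bar>D\<bar> * B)"
  unfolding lin_bound_def
proof (intro allI impI)
  fix \<epsilon> :: real assume "\<epsilon> > 0"
  \<comment> \<open>Continuity of this product at \<eta> = 0, used with \<open>E\<close> equal to
    \<open>A\<close> and to \<open>B\<close>, yields one \<eta> > 0 small enough for both
    coefficients.\<close>
  have "((\<lambda>\<eta>. (\<bar>D\<bar> + \<eta>) * (E + \<eta>)) \<longlongrightarrow> (\<bar>D\<bar> + 0) * (E + 0)) (at_right 0)" for E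
    by (intro tendsto_intros)
  then have lim: "((\<lambda>\<eta>. (\<bar>D\<bar> + \<eta>) * (E + \<eta>)) \<longlongrightarrow> \<bar>D\<bar> * E) (at_right 0)" for E
    by simp
  have "\<forall>\<^sub>F \<eta> in at_right 0. (\<bar>D\<bar> + \<eta>) * (A + \<eta>) < \<bar>D\<bar> * A + \<epsilon>"
       "\<forall>\<^sub>F \<eta> in at_right 0. (\<bar>D\<bar> + \<eta>) * (B + \<eta>) < \<bar>D\<bar> * B + \<epsilon>"
    using \<open>\<epsilon> > 0\<close> order_tendstoD(2)[OF lim[of A], of "\<bar>D\<bar> * A + \<epsilon>"]
      order_tendstoD(2)[OF lim[of B], of "\<bar>D\<bar> * B + \<epsilon>"] by simp_all
  moreover have "\<forall>\<^sub>F \<eta> in at_right 0. \<eta> > (0::real)"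
    by (simp add: eventually_at_right_less)
  ultimately have "\<forall>\<^sub>F \<eta> in at_right 0. \<eta> > 0 \<and> (\<bar>D\<bar> + \<eta>) * (A + \<eta>) < \<bar>D\<bar> * A + \<epsilon>
      \<and> (\<bar>D\<bar> + \<eta>) * (B + \<eta>) < \<bar>D\<bar> * B + \<epsilon>"
    by eventually_elim simp
  then obtain \<eta> where \<eta>: "\<eta> > 0" "(\<bar>D\<bar> + \<eta>) * (A + \<eta>) < \<bar>D\<bar> * A + \<epsilon>"
      "(\<bar>D\<bar> + \<eta>) * (B + \<eta>) < \<bar>D\<bar> * B + \<epsilon>"
    using eventually_happens'[OF trivial_limit_at_right_real] by blast
  \<comment> \<open>The derivative controls only a punctured neighbourhood, while \<open>f i\<close>
    may equal \<open>l\<close>. At \<open>y = l\<close> both sides vanish, so the full neighbourhood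
    is allowed.\<close>
  have "\<forall>\<^sub>F y in nhds l. \<bar>g y - g l\<bar> \<le> (\<bar>D\<bar> + \<eta>) * \<bar>y - l\<bar>"
  proof -
    have "((\<lambda>y. \<bar>(g y - g l) / (y - l)\<bar>) \<longlongrightarrow> \<bar>D\<bar>) (at l)"
      using g by (intro tendsto_rabs) (simp add: has_field_derivative_iff)
    then have "\<forall>\<^sub>F y in at l. \<bar>(g y - g l) / (y - l)\<bar> < \<bar>D\<bar> + \<eta>"
      by (rule order_tendstoD(2)) (use \<eta>(1) in linarith)
    then have "\<forall>\<^sub>F y in at l. \<bar>g y - g l\<bar> \<le> (\<bar>D\<bar> + \<eta>) * \<bar>y - l\<bar>"
      unfolding eventually_at_filter
      by eventually_elim (auto simp: abs_divide divide_less_eq)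
    then show ?thesis
      unfolding eventually_at_filter
    proof eventually_elim
      case (elim y)
      then show ?case by (cases "y = l") simp_all
    qed
  qed
  then have "\<forall>\<^sub>F i in F. \<bar>g (f i) - g l\<bar> \<le> (\<bar>D\<bar> + \<eta>) * \<bar>f i - l\<bar>"
    using lin_bound_tendsto[OF f a(1) b(1)] by (rule eventually_compose_filterlim)
  moreover have "\<forall>\<^sub>F i in F. \<bar>f i - l\<bar> \<le> (A + \<eta>) * a i + (B + \<eta>) * b i"
    using f \<eta>(1) by (rule lin_boundD)
  ultimately show "\<forall>\<^sub>F i in F. \<bar>g (f i) - g l\<bar> \<le> (\<bar>D\<bar> * A + \<epsilon>) * a i + (\<bar>D\<bar> * B + \<epsilon>) * b i"
  proof eventually_elim
    case (elim i)
    have "\<bar>g (f i) - g l\<bar> \<le> (\<bar>D\<bar> + \<eta>) * ((A + \<eta>) * a i + (B + \<eta>) * b i)"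
      using \<eta>(1) by (intro order_trans[OF elim(1)] mult_left_mono elim(2)) simp
    also have "\<dots> = (\<bar>D\<bar> + \<eta>) * (A + \<eta>) * a i + (\<bar>D\<bar> + \<eta>) * (B + \<eta>) * b i"
      by (simp add: algebra_simps)
    also have "\<dots> \<le> (\<bar>D\<bar> * A + \<epsilon>) * a i + (\<bar>D\<bar> * B + \<epsilon>) * b i"
      using \<eta> a b by (intro add_mono mult_right_mono) auto
    finally show ?case .
  qed
qed

section \<open>Supremum deviation of mass vectors\<close>

lemma sup_dev_ge: "j \<in> {1..r} \<Longrightarrow> \<bar>u j - v j\<bar> \<le> sup_dev r u v"
  unfolding sup_dev_def by (rule cSUP_upper) auto

lemma sup_dev_nonneg: "r \<ge> 1 \<Longrightarrow> 0 \<le> sup_dev r u v"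
  using sup_dev_ge[of 1 r u v] by force

lemma sup_dev_le_sum:
  assumes "r \<ge> 1"
  shows "sup_dev r u v \<le> (\<Sum>j\<in>{1..r}. \<bar>u j - v j\<bar>)"
  unfolding sup_dev_def
  using assms by (intro cSUP_least member_le_sum) auto

text \<open>With finitely many coordinates the supremum is squeezed between 0 and the sum of the
  deviations, so coordinatewise convergence suffices.\<close>

lemma sup_dev_tendsto_0:
  assumes "r \<ge> 1" "\<And>j. j \<in> {1..r} \<Longrightarrow> ((\<lambda>i. u i j) \<longlongrightarrow> v j) F"
  shows "((\<lambda>i. sup_dev r (u i) v) \<longlongrightarrow> 0) F"
proof (rule tendsto_sandwich[OF _ _ tendsto_const])
  have "((\<lambda>i. \<Sum>j\<in>{1..r}. \<bar>u i j - v j\<bar>) \<longlongrightarrow> (\<Sum>j\<in>{1..r}. \<bar>v j - v j\<bar>)) F"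
    using assms(2) by (intro tendsto_intros)
  then show "((\<lambda>i. \<Sum>j\<in>{1..r}. \<bar>u i j - v j\<bar>) \<longlongrightarrow> 0) F" by simp
qed (intro always_eventually allI sup_dev_nonneg sup_dev_le_sum assms(1))+

section \<open>First-order estimate for the divergence\<close>

text \<open>The constants are the absolute partial derivatives of \<open>x powr s * y powr t\<close>
  at the limit point. Passing through logarithms turns the product into a sum, so addition and the
  one-variable chain rule are enough.\<close>

lemma lin_bound_powr_mult:
  assumes x: "lin_bound F a b x x0 1 0" "x0 > 0" and y: "lin_bound F a b y y0 0 1" "y0 > 0"
    and a: "(a \<longlongrightarrow> 0) F" "\<And>i. 0 \<le> a i" and b: "(b \<longlongrightarrow> 0) F" "\<And>i. 0 \<le> b i"
  shows "lin_bound F a b (\<lambda>i. x i powr s * y i powr t) (x0 powr s * y0 powr t)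
     (\<bar>s\<bar> * (x0 powr s * y0 powr t / x0)) (\<bar>t\<bar> * (x0 powr s * y0 powr t / y0))"
proof -
  have "lin_bound F a b (\<lambda>i. s * ln (x i)) (s * ln x0) (\<bar>s / x0\<bar> * 1) (\<bar>s / x0\<bar> * 0)"
    using x(2) by (intro lin_bound_compose[OF x(1) _ a b, where g = "\<lambda>x. s * ln x"])
      (auto intro!: derivative_eq_intros)
  moreover have "lin_bound F a b (\<lambda>i. t * ln (y i)) (t * ln y0) (\<bar>t / y0\<bar> * 0) (\<bar>t / y0\<bar> * 1)"
    using y(2) by (intro lin_bound_compose[OF y(1) _ a b, where g = "\<lambda>x. t * ln x"])
      (auto intro!: derivative_eq_intros)
  ultimately have "lin_bound F a b (\<lambda>i. s * ln (x i) + t * ln (y i)) (s * ln x0 + t * ln y0)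
      (\<bar>s / x0\<bar> * 1 + \<bar>t / y0\<bar> * 0) (\<bar>s / x0\<bar> * 0 + \<bar>t / y0\<bar> * 1)"
    by (rule lin_bound_add)
  from lin_bound_compose[OF this DERIV_exp a b]
  have "lin_bound F a b (\<lambda>i. exp (s * ln (x i) + t * ln (y i))) (x0 powr s * y0 powr t)
     (\<bar>s\<bar> * (x0 powr s * y0 powr t / x0)) (\<bar>t\<bar> * (x0 powr s * y0 powr t / y0))"
    using x(2) y(2) by (simp add: exp_add powr_def abs_mult mult_ac)
  \<comment> \<open>The exponential form and \<open>powr\<close> disagree at 0, where
    \<open>powr\<close> gives 0. The positive limits exclude this eventually.\<close>
  moreover have "\<forall>\<^sub>F i in F. x i > 0" "\<forall>\<^sub>F i in F. y i > 0"
    using x y lin_bound_tendsto[OF x(1) a(1) b(1)] lin_bound_tendsto[OF y(1) a(1) b(1)]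
    by (auto intro: order_tendstoD)
  then have "\<forall>\<^sub>F i in F. exp (s * ln (x i) + t * ln (y i)) = x i powr s * y i powr t"
    by eventually_elim (simp add: exp_add powr_def)
  ultimately show ?thesis
    by (rule lin_bound_cong)
qed

lemma S_alpha_pos:
  assumes "r \<ge> 1" "\<forall>j\<in>{1..r}. p j > 0" "\<forall>j\<in>{1..r}. q j > 0"
  shows "S_alpha r \<alpha> p q > 0"
  unfolding S_alpha_def
proof (intro sum_pos)
  fix j assume "j \<in> {1..r}"
  then have "p j > 0" "q j > 0" using assms by auto
  then show "p j powr \<alpha> * q j powr (1 - \<alpha>) > 0" by simp
qed (use assms in auto)

lemma renyi_div_eq:
  assumes "r \<ge> 1" "\<forall>j\<in>{1..r}. p j > 0" "\<forall>j\<in>{1..r}. q j > 0"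
  shows "renyi_div r \<alpha> p q = 1 / (\<alpha> - 1) * ln (S_alpha r \<alpha> p q)"
  using assms S_alpha_pos[OF assms] by (fastforce simp: renyi_div_def renyi_defined_def)

text \<open>Deterministic core of all three limits. Deviations are measured in the supremum norm, so
  each constant is the dual norm of a gradient: the sum of the absolute partial derivatives of the
  divergence in the entries of \<open>p\<close>, respectively of \<open>q\<close>.\<close>

lemma lin_bound_renyi_div:
  assumes r: "r \<ge> 1" and p: "\<forall>j\<in>{1..r}. p j > 0" and q: "\<forall>j\<in>{1..r}. q j > 0"
    and \<alpha>: "\<alpha> > 0" "\<alpha> \<noteq> 1"
    and u: "\<And>j. j \<in> {1..r} \<Longrightarrow> ((\<lambda>i. u i j) \<longlongrightarrow> p j) F"
    and v: "\<And>j. j \<in> {1..r} \<Longrightarrow> ((\<lambda>i. v i j) \<longlongrightarrow> q j) F"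
  shows "lin_bound F (\<lambda>i. sup_dev r (u i) p) (\<lambda>i. sup_dev r (v i) q)
    (\<lambda>i. renyi_div r \<alpha> (u i) (v i)) (renyi_div r \<alpha> p q) (A_R1 r \<alpha> p q) (A_R2 r \<alpha> p q)"
proof -
  let ?a = "\<lambda>i. sup_dev r (u i) p" and ?b = "\<lambda>i. sup_dev r (v i) q"
  let ?h = "\<lambda>j. p j powr \<alpha> * q j powr (1 - \<alpha>)" and ?S = "S_alpha r \<alpha> p q"
  have a: "(?a \<longlongrightarrow> 0) F" "0 \<le> ?a i" and b: "(?b \<longlongrightarrow> 0) F" "0 \<le> ?b i" for i
    using r u v by (auto intro: sup_dev_tendsto_0 sup_dev_nonneg)
  have S: "?S > 0" using r p q by (rule S_alpha_pos)
  \<comment> \<open>Each coordinate deviates by at most the supremum for its own vector, whence the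
    constants 1 and 0.\<close>
  have "lin_bound F ?a ?b (\<lambda>i. u i j) (p j) 1 0" "lin_bound F ?a ?b (\<lambda>i. v i j) (q j) 0 1"
    if j: "j \<in> {1..r}" for j
    unfolding lin_bound_def
    using sup_dev_ge[OF j] a(2) b(2)
    by (auto intro!: always_eventually simp: algebra_simps add_increasing2)
  then have "lin_bound F ?a ?b (\<lambda>i. u i j powr \<alpha> * v i j powr (1 - \<alpha>)) (?h j)
      (\<bar>\<alpha>\<bar> * (?h j / p j)) (\<bar>1 - \<alpha>\<bar> * (?h j / q j))" if "j \<in> {1..r}" for j
    using that by (intro lin_bound_powr_mult a b bspec[OF p] bspec[OF q])
  then have "lin_bound F ?a ?b (\<lambda>i. S_alpha r \<alpha> (u i) (v i)) ?S
      (\<Sum>j\<in>{1..r}. \<bar>\<alpha>\<bar> * (?h j / p j)) (\<Sum>j\<in>{1..r}. \<bar>1 - \<alpha>\<bar> * (?h j / q j))"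
    unfolding S_alpha_def by (intro lin_bound_sum a b)
  moreover have "((\<lambda>s. 1 / (\<alpha> - 1) * ln s) has_real_derivative 1 / (\<alpha> - 1) / ?S) (at ?S)"
    using S \<alpha> by (auto intro!: derivative_eq_intros)
  ultimately have L: "lin_bound F ?a ?b (\<lambda>i. 1 / (\<alpha> - 1) * ln (S_alpha r \<alpha> (u i) (v i))) (renyi_div r \<alpha> p q)
      (\<bar>1 / (\<alpha> - 1) / ?S\<bar> * (\<Sum>j\<in>{1..r}. \<bar>\<alpha>\<bar> * (?h j / p j)))
      (\<bar>1 / (\<alpha> - 1) / ?S\<bar> * (\<Sum>j\<in>{1..r}. \<bar>1 - \<alpha>\<bar> * (?h j / q j)))"
    unfolding renyi_div_eq[OF r p q] by (rule lin_bound_compose) (fact a b)+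
  have "?h j / p j = (p j / q j) powr (\<alpha> - 1)" "?h j / q j = (p j / q j) powr \<alpha>"
    if "j \<in> {1..r}" for j
    using bspec[OF p that] bspec[OF q that]
    by (simp_all add: powr_divide powr_diff field_simps)
  \<comment> \<open>The factor \<open>\<bar>\<alpha> - 1\<bar>\<close> from differentiating in
    \<open>q\<close> cancels the one in the derivative of the outer logarithm. This is why
    \<open>A_T2\<close>, unlike \<open>A_T1\<close>, carries no prefactor.\<close>
  then have "(\<Sum>j\<in>{1..r}. \<bar>\<alpha>\<bar> * (?h j / p j)) = \<alpha> * (\<Sum>j\<in>{1..r}. (p j / q j) powr (\<alpha> - 1))"
    "(\<Sum>j\<in>{1..r}. \<bar>1 - \<alpha>\<bar> * (?h j / q j)) = \<bar>\<alpha> - 1\<bar> * (\<Sum>j\<in>{1..r}. (p j / q j) powr \<alpha>)"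
    unfolding sum_distrib_left using \<alpha>(1) by (auto intro!: sum.cong)
  moreover have "\<bar>1 / (\<alpha> - 1) / ?S\<bar> = 1 / \<bar>\<alpha> - 1\<bar> / ?S"
    using S by (simp add: abs_divide abs_mult)
  ultimately have AB: "\<bar>1 / (\<alpha> - 1) / ?S\<bar> * (\<Sum>j\<in>{1..r}. \<bar>\<alpha>\<bar> * (?h j / p j)) = A_R1 r \<alpha> p q"
    "\<bar>1 / (\<alpha> - 1) / ?S\<bar> * (\<Sum>j\<in>{1..r}. \<bar>1 - \<alpha>\<bar> * (?h j / q j)) = A_R2 r \<alpha> p q"
    using \<alpha>(2) by (simp_all only: A_R1_def A_T1_def A_R2_def A_T2_def) simp_all
  \<comment> \<open>Finitely many positive limits keep all entries eventually positive, so the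
    default value 0 of \<open>renyi_div\<close> does not affect the estimate.\<close>
  have "\<forall>\<^sub>F i in F. \<forall>j\<in>{1..r}. u i j > 0" "\<forall>\<^sub>F i in F. \<forall>j\<in>{1..r}. v i j > 0"
    using order_tendstoD(1)[OF u bspec[OF p]] order_tendstoD(1)[OF v bspec[OF q]]
    by (simp_all add: eventually_ball_finite_distrib)
  then have "\<forall>\<^sub>F i in F. renyi_div r \<alpha> (u i) (v i) = 1 / (\<alpha> - 1) * ln (S_alpha r \<alpha> (u i) (v i))"
    by eventually_elim (rule renyi_div_eq[OF r])
  then show ?thesis
    by (intro lin_bound_cong[OF L[unfolded AB]]) (simp add: eq_commute)
qed

section \<open>Passage to the upper limit of quotients\<close>

text \<open>Where \<open>d i\<close> vanishes the quotient is 0 by the convention for division, and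
  \<open>C \<ge> 0\<close> covers this case. Elsewhere the assumed bound is divided by
  \<open>d i\<close>.\<close>

lemma Limsup_divide_le:
  fixes d :: "'i \<Rightarrow> real"
  assumes "\<And>i. d i \<ge> 0" "C \<ge> 0"
    and "\<And>\<epsilon>. \<epsilon> > 0 \<Longrightarrow> \<forall>\<^sub>F i in F. g i \<le> (C + \<epsilon>) * d i"
  shows "Limsup F (\<lambda>i. ereal (g i / d i)) \<le> ereal C"
proof (rule ereal_le_epsilon2)
  fix \<epsilon> :: real assume "\<epsilon> > 0"
  show "Limsup F (\<lambda>i. ereal (g i / d i)) \<le> ereal C + ereal \<epsilon>"
    using assms(3)[OF \<open>\<epsilon> > 0\<close>]
  proof (intro Limsup_bounded, eventually_elim)
    case (elim i)
    then show ?case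
      using assms(1)[of i] assms(2) \<open>\<epsilon> > 0\<close>
      by (cases "d i = 0") (auto simp: divide_le_eq)
  qed
qed

section \<open>Almost sure convergence of empirical probabilities\<close>

text \<open>A strong law for bounded variables: a deviation of the average by \<delta> has
  probability at most geometric in \<open>n\<close>, hence summable, so almost surely it occurs only
  finitely often.\<close>

lemma (in prob_space) average_indep_vars_tendsto:
  fixes Z :: "nat \<Rightarrow> 'a \<Rightarrow> real"
  assumes ind: "indep_vars (\<lambda>_. borel) Z {1..}"
    and Z: "\<And>i \<omega>. i \<ge> 1 \<Longrightarrow> \<omega> \<in> space M \<Longrightarrow> Z i \<omega> \<in> {0..1}"
    and E: "\<And>i. i \<ge> 1 \<Longrightarrow> expectation (Z i) = \<mu>"
  shows "AE \<omega> in M. (\<lambda>n. 1 / real n * (\<Sum>i\<in>{1..n}. Z i \<omega>)) \<longlonglongrightarrow> \<mu>"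
proof -
  have [measurable]: "Z i \<in> borel_measurable M" if "i \<ge> 1" for i
    using ind that by (auto simp: indep_vars_def)
  have sum_meas: "(\<lambda>\<omega>. \<Sum>i\<in>{1..n}. Z i \<omega>) \<in> borel_measurable M" for n
    by (intro borel_measurable_sum) simp
  have "AE \<omega> in M. \<forall>\<^sub>F n in sequentially. \<bar>1 / real n * (\<Sum>i\<in>{1..n}. Z i \<omega>) - \<mu>\<bar> < \<delta>"
    if \<delta>: "\<delta> > 0" for \<delta>
  proof -
    define B where "B n = {\<omega>\<in>space M. \<bar>(\<Sum>i\<in>{1..n}. Z i \<omega>) - real n * \<mu>\<bar> \<ge> real n * \<delta>}" for n
    have meas: "B n \<in> sets M" for n
      unfolding B_def using sum_meas by measurable
    have le: "prob (B n) \<le> 2 * exp (-2 * \<delta>\<^sup>2) ^ n" for n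
    \<comment> \<open>The Hoeffding exponent has the sum of squared ranges, here \<open>n\<close>,
      as its denominator. For \<open>n = 0\<close> the claimed bound is 2 and exceeds every
      probability.\<close>
    proof (cases "n = 0")
      case True
      then show ?thesis by (intro order_trans[OF prob_le_1]) simp
    next
      case False
      interpret Hoeffding_ineq M "{1..n}" Z "\<lambda>_. 0" "\<lambda>_. 1" "real n * \<mu>"
      proof unfold_locales
        show "indep_vars (\<lambda>_. borel) Z {1..n}"
          using ind by (rule indep_vars_subset) auto
        show "AE \<omega> in M. Z i \<omega> \<in> {0..1}" if "i \<in> {1..n}" for i
          using that Z by (intro AE_I2) auto
        show "real n * \<mu> \<equiv> \<Sum>i\<in>{1..n}. expectation (Z i)"
          using E by simp
      qed simp
      have "prob (B n) \<le> 2 * exp (-2 * (real n * \<delta>)\<^sup>2 / (\<Sum>i\<in>{1..n}. (1 - 0)\<^sup>2))"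
        unfolding B_def using \<delta> False by (intro Hoeffding_ineq_abs_ge) auto
      \<comment> \<open>Being linear in \<open>n\<close>, the exponent makes the bound a geometric
        sequence with ratio below 1.\<close>
      also have "-2 * (real n * \<delta>)\<^sup>2 / (\<Sum>i\<in>{1..n}. (1 - 0)\<^sup>2) = real n * (-2 * \<delta>\<^sup>2)"
        using False by (simp add: power2_eq_square)
      finally show ?thesis by (simp only: exp_of_nat_mult)
    qed
    have "summable (\<lambda>n. 2 * exp (-2 * \<delta>\<^sup>2) ^ n)"
      using \<delta> by (intro summable_mult summable_geometric) simp
    then have "summable (\<lambda>n. prob (B n))"
      by (rule summable_comparison_test') (use le in auto)
    then have "AE \<omega> in M. \<forall>\<^sub>F n in sequentially. \<omega> \<in> space M - B n"
      using meas by (intro borel_cantelli_AE1) (auto simp: emeasure_eq_measure)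
    then show ?thesis
    proof eventually_elim
      case (elim \<omega>)
      then show ?case
        using eventually_gt_at_top[of 0]
      proof eventually_elim
        case (elim n)
        have "\<bar>(\<Sum>i\<in>{1..n}. Z i \<omega>) - real n * \<mu>\<bar> < real n * \<delta>"
          using elim by (auto simp: B_def)
        moreover have "1 / real n * (\<Sum>i\<in>{1..n}. Z i \<omega>) - \<mu> = ((\<Sum>i\<in>{1..n}. Z i \<omega>) - real n * \<mu>) / real n"
          using elim by (simp add: field_simps)
        ultimately show ?case
          using elim by (simp add: abs_divide divide_less_eq mult.commute)
      qed
    qed
  qed
  \<comment> \<open>Restricting \<delta> to the countable family \<open>1 / real (Suc k)\<close>
    allows one common null set.\<close>
  then have "AE \<omega> in M. \<forall>k. \<forall>\<^sub>F n in sequentially.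
      \<bar>1 / real n * (\<Sum>i\<in>{1..n}. Z i \<omega>) - \<mu>\<bar> < 1 / real (Suc k)"
    by (simp add: AE_all_countable)
  then show ?thesis
  proof eventually_elim
    case (elim \<omega>)
    show ?case
    proof (rule tendstoI)
      fix e :: real assume "e > 0"
      then obtain k where "1 / real (Suc k) < e"
        using nat_approx_posE by blast
      then show "\<forall>\<^sub>F n in sequentially. dist (1 / real n * (\<Sum>i\<in>{1..n}. Z i \<omega>)) \<mu> < e"
        using elim[rule_format, of k] by (auto elim!: eventually_mono simp: dist_real_def)
    qed
  qed
qed

text \<open>At each point \<open>c j\<close> the empirical probability averages independent
  indicators with mean \<open>p j\<close>. The finitely many exceptional null sets are then
  united.\<close>

lemma empirical_tendsto:
  assumes "prob_space M" "iid_sample M r c p X"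
  shows "AE \<omega> in M. \<forall>j\<in>{1..r}. (\<lambda>n. empirical c X n \<omega> j) \<longlonglongrightarrow> p j"
proof -
  interpret prob_space M by fact
  have ind: "indep_vars (\<lambda>_. count_space (c ` {1..r})) X {1..}"
    and pr: "\<And>i j. i \<ge> 1 \<Longrightarrow> j \<in> {1..r} \<Longrightarrow> prob {\<omega>\<in>space M. X i \<omega> = c j} = p j"
    using assms(2) by (auto simp: iid_sample_def)
  have "AE \<omega> in M. (\<lambda>n. empirical c X n \<omega> j) \<longlonglongrightarrow> p j" if j: "j \<in> {1..r}" for j
  proof -
    define Z where "Z i \<omega> = (indicator {c j} (X i \<omega>) :: real)" for i \<omega>
    have Zind: "indep_vars (\<lambda>_. borel) Z {1..}"
      unfolding Z_def by (rule indep_vars_compose2[OF ind]) auto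
    have E: "expectation (Z i) = p j" if "i \<ge> 1" for i
    proof -
      have "X i \<in> M \<rightarrow>\<^sub>M count_space (c ` {1..r})"
        using ind that by (auto simp: indep_vars_def)
      then have "X i -` {c j} \<inter> space M \<in> sets M"
        using j by (intro measurable_sets) auto
      then have "{\<omega>\<in>space M. X i \<omega> = c j} \<in> sets M"
        by (simp add: vimage_def Int_def conj_commute)
      moreover have "expectation (Z i) = expectation (indicator {\<omega>\<in>space M. X i \<omega> = c j})"
        by (intro Bochner_Integration.integral_cong) (auto simp: Z_def indicator_def)
      ultimately show ?thesis
        using pr[OF that j] by simp
    qed
    have "Z i \<omega> \<in> {0..1}" for i \<omega>
      by (simp add: Z_def indicator_def)
    then have "AE \<omega> in M. (\<lambda>n. 1 / real n * (\<Sum>i\<in>{1..n}. Z i \<omega>)) \<longlonglongrightarrow> p j"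
      by (intro average_indep_vars_tendsto Zind E)
    moreover have "empirical c X n \<omega> j = 1 / real n * (\<Sum>i\<in>{1..n}. Z i \<omega>)" for n \<omega>
      by (simp add: empirical_def Z_def indicator_def)
    ultimately show ?thesis by simp
  qed
  then show ?thesis by (simp add: AE_finite_all)
qed

section \<open>The almost sure bounds for one and two samples\<close>

theorem corollary5:
  fixes M :: "'w measure" and r :: nat and c :: "nat \<Rightarrow> 'a"
    and p q :: "nat \<Rightarrow> real" and \<alpha> :: real
    and X Y :: "nat \<Rightarrow> 'w \<Rightarrow> 'a"
  assumes "prob_space M"
    and "r \<ge> 2" and "inj_on c {1..r}"
    and "prob_vector r p" and "\<forall>j\<in>{1..r}. p j > 0"
    and "prob_vector r q" and "\<forall>j\<in>{1..r}. q j > 0"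
    and "\<alpha> > 0" and "\<alpha> \<noteq> 1"
    and "iid_sample M r c p X" and "iid_sample M r c q Y"
    and "indep_samples M r c X Y"
  shows
    "(AE \<omega> in M.
        limsup (\<lambda>n. ereal (\<bar>renyi_div r \<alpha> (empirical c X n \<omega>) q - renyi_div r \<alpha> p q\<bar>
                           / sup_dev r (empirical c X n \<omega>) p))
          \<le> ereal (A_R1 r \<alpha> p q)) \<and>
     (AE \<omega> in M.
        limsup (\<lambda>n. ereal (\<bar>renyi_div r \<alpha> p (empirical c Y n \<omega>) - renyi_div r \<alpha> p q\<bar>
                           / sup_dev r (empirical c Y n \<omega>) q))
          \<le> ereal (A_R2 r \<alpha> p q)) \<and>
     (AE \<omega> in M.
        limsup2 (\<lambda>n m. ereal (\<bar>renyi_div r \<alpha> (empirical c X n \<omega>) (empirical c Y m \<omega>)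
                                - renyi_div r \<alpha> p q\<bar>
                              / max (sup_dev r (empirical c X n \<omega>) p)
                                    (sup_dev r (empirical c Y m \<omega>) q)))
          \<le> ereal (A_R1 r \<alpha> p q + A_R2 r \<alpha> p q))"
proof (intro conjI)
  have r: "r \<ge> 1" using assms(2) by simp
  note bound = lin_bound_renyi_div[OF r assms(5,7-9)]
  have S: "S_alpha r \<alpha> p q > 0" using r assms(5,7) by (rule S_alpha_pos)
  have "A_T1 r \<alpha> p q \<ge> 0" "A_T2 r \<alpha> p q \<ge> 0"
    using assms(8) by (simp_all add: A_T1_def A_T2_def sum_nonneg)
  then have A: "A_R1 r \<alpha> p q \<ge> 0" "A_R2 r \<alpha> p q \<ge> 0"
    using S by (simp_all add: A_R1_def A_R2_def)
  \<comment> \<open>A distribution that is not estimated enters as a constant vector with deviation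
    0, so its term drops out and only one of the two constants remains.\<close>
  have sup0: "sup_dev r u u = 0" for u
    using r by (simp add: sup_dev_def)
  have X: "AE \<omega> in M. \<forall>j\<in>{1..r}. (\<lambda>n. empirical c X n \<omega> j) \<longlonglongrightarrow> p j"
    and Y: "AE \<omega> in M. \<forall>j\<in>{1..r}. (\<lambda>n. empirical c Y n \<omega> j) \<longlonglongrightarrow> q j"
    using empirical_tendsto assms by blast+
  show "AE \<omega> in M.
        limsup (\<lambda>n. ereal (\<bar>renyi_div r \<alpha> (empirical c X n \<omega>) q - renyi_div r \<alpha> p q\<bar>
                           / sup_dev r (empirical c X n \<omega>) p))
          \<le> ereal (A_R1 r \<alpha> p q)"
    using X
  proof eventually_elim
    case (elim \<omega>)
    have "lin_bound sequentially (\<lambda>n. sup_dev r (empirical c X n \<omega>) p) (\<lambda>_. sup_dev r q q)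
        (\<lambda>n. renyi_div r \<alpha> (empirical c X n \<omega>) q) (renyi_div r \<alpha> p q) (A_R1 r \<alpha> p q) (A_R2 r \<alpha> p q)"
      using elim by (intro bound tendsto_const) auto
    from lin_boundD[OF this] show ?case
      using A r by (intro Limsup_divide_le sup_dev_nonneg) (simp_all add: sup0)
  qed
  show "AE \<omega> in M.
        limsup (\<lambda>n. ereal (\<bar>renyi_div r \<alpha> p (empirical c Y n \<omega>) - renyi_div r \<alpha> p q\<bar>
                           / sup_dev r (empirical c Y n \<omega>) q))
          \<le> ereal (A_R2 r \<alpha> p q)"
    using Y
  proof eventually_elim
    case (elim \<omega>)
    have "lin_bound sequentially (\<lambda>_. sup_dev r p p) (\<lambda>n. sup_dev r (empirical c Y n \<omega>) q)
        (\<lambda>n. renyi_div r \<alpha> p (empirical c Y n \<omega>)) (renyi_div r \<alpha> p q) (A_R1 r \<alpha> p q) (A_R2 r \<alpha> p q)"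
      using elim by (intro bound tendsto_const) auto
    from lin_boundD[OF this] show ?case
      using A r by (intro Limsup_divide_le sup_dev_nonneg) (simp_all add: sup0)
  qed
  show "AE \<omega> in M.
        limsup2 (\<lambda>n m. ereal (\<bar>renyi_div r \<alpha> (empirical c X n \<omega>) (empirical c Y m \<omega>)
                                - renyi_div r \<alpha> p q\<bar>
                              / max (sup_dev r (empirical c X n \<omega>) p)
                                    (sup_dev r (empirical c Y m \<omega>) q)))
          \<le> ereal (A_R1 r \<alpha> p q + A_R2 r \<alpha> p q)"
    using X Y
  proof eventually_elim
    case (elim \<omega>)
    let ?F = "sequentially \<times>\<^sub>F sequentially"
    let ?u = "\<lambda>z. empirical c X (fst z) \<omega>" and ?v = "\<lambda>z. empirical c Y (snd z) \<omega>"
    let ?a = "\<lambda>z. sup_dev r (?u z) p" and ?b = "\<lambda>z. sup_dev r (?v z) q"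
    \<comment> \<open>The limits in \<open>n\<close> and in \<open>m\<close> are pulled back along
      the projections to the product filter, which is the filter behind
      \<open>limsup2\<close>.\<close>
    have u: "((\<lambda>z. ?u z j) \<longlongrightarrow> p j) ?F" if "j \<in> {1..r}" for j
      using elim(1) that by (intro filterlim_compose[OF _ filterlim_fst]) auto
    have v: "((\<lambda>z. ?v z j) \<longlongrightarrow> q j) ?F" if "j \<in> {1..r}" for j
      using elim(2) that by (intro filterlim_compose[OF _ filterlim_snd]) auto
    have b: "lin_bound ?F ?a ?b (\<lambda>z. renyi_div r \<alpha> (?u z) (?v z)) (renyi_div r \<alpha> p q)
        (A_R1 r \<alpha> p q) (A_R2 r \<alpha> p q)"
      by (intro bound u v)
    have "Limsup ?F (\<lambda>z. ereal (\<bar>renyi_div r \<alpha> (?u z) (?v z) - renyi_div r \<alpha> p q\<bar> / max (?a z) (?b z)))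
        \<le> ereal (A_R1 r \<alpha> p q + A_R2 r \<alpha> p q)"
    proof (rule Limsup_divide_le)
      fix \<epsilon> :: real assume "\<epsilon> > 0"
      \<comment> \<open>Each constant receives half of \<epsilon>. As both constants are
        nonnegative, replacing each deviation by the maximum only increases the bound, and the
        constants add up.\<close>
      then have e: "\<epsilon> / 2 > 0" by simp
      show "\<forall>\<^sub>F z in ?F. \<bar>renyi_div r \<alpha> (?u z) (?v z) - renyi_div r \<alpha> p q\<bar>
          \<le> (A_R1 r \<alpha> p q + A_R2 r \<alpha> p q + \<epsilon>) * max (?a z) (?b z)"
        using lin_boundD[OF b e]
      proof eventually_elim
        case (elim z)
        also have "(A_R1 r \<alpha> p q + \<epsilon> / 2) * ?a z + (A_R2 r \<alpha> p q + \<epsilon> / 2) * ?b z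
            \<le> (A_R1 r \<alpha> p q + \<epsilon> / 2) * max (?a z) (?b z) + (A_R2 r \<alpha> p q + \<epsilon> / 2) * max (?a z) (?b z)"
          using A e by (intro add_mono mult_left_mono) auto
        finally show ?case by (simp add: algebra_simps)
      qed
    qed (use A r in \<open>auto simp: sup_dev_nonneg le_max_iff_disj\<close>)
    then show ?case by (simp add: limsup2_eq_Limsup case_prod_unfold)
  qed
qed

end
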